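(* Let $1<p<\infty$ and $0<\gamma<1$. If $A_1\subset A_2\subset\cdots$ are subsets of $X$ and $A=\bigcup_{i=1}^\infty A_i$, then $$\lim_{i\to\infty}\mathcal{C}_{\gamma,p}(A_i)=\mathcal{C}_{\gamma,p}(A),$$ that is, the Riesz capacity $\mathcal{C}_{\gamma,p}$ is a Fatou capacity.
   Context: Setting: $X=(X,d,\mu)$ is a locally compact metric space equipped with a Borel regular outer measure $\mu$ that is doubling, i.e. there is a constant $c_d\ge 1$ with $\mu(B(x,2r))\le c_d\,\mu(B(x,r))$ for every ball $B(x,r)=\{y\in X: d(y,x)<r\}$. Every open ball has positive and finite measure. Spheres have measure zero, $\mu(\{y\in X: d(x,y)=r\})=0$ for all $x\in X$, $r>0$, and points have measure zero, $\mu(\{x\})=0$ for all $x\in X$. For $0<\gamma<1$, the Riesz potential of order $\gamma$ of a measurable function $f$ is $$I_\gamma f(x)=\int_X \frac{f(y)}{\mu(B(x,d(x,y)))^{1-\gamma}}\,d\mu(y)$$ (the single point $y=x$ may be omitted from the domain of integration, since it is $\mu$-null). $L^p_+(X)$ denotes the set of non-negative functions in $L^p(X)=L^p(X,\mu)$. For $1<p<\infty$ and any $E\subset X$, the Riesz $(\gamma,p)$-capacity is $\mathcal{C}_{\gamma,p}(E)=\inf_{f\in\mathcal{A}(E)}\|f\|_{L^p(X)}^p$, where $\mathcal{A}(E)=\{f\in L^p_+(X): I_\gamma f\ge 1\text{ on }E\}$ and $\mathcal{C}_{\gamma,p}(E)=\infty$ if $\mathcal{A}(E)=\emptyset$. A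 capacity $\mathcal{C}$ is called a Fatou capacity if $\mathcal{C}(A_i)\to\mathcal{C}(A)$ whenever $A_1\subset A_2\subset\cdots$ are subsets of $X$ and $A=\bigcup_{i=1}^\infty A_i$. The values of the capacity lie in $[0,\infty]$. *)

theory Defs
  imports "HOL-Analysis.Analysis"
begin

text \<open>
  The carrier \<open>X\<close> is the type \<open>'a\<close>. An outer measure \<open>\<mu>\<close> is a function on all subsets of \<open>X\<close>;
  its measurable sets are the Caratheodory measurable ones, which form the library's
  \<^const>\<open>lambda_system\<close>.
\<close>

definition caratheodory_measure :: "('a set \<Rightarrow> ennreal) \<Rightarrow> 'a measure" where
  "caratheodory_measure \<mu> = measure_of UNIV (lambda_system UNIV UNIV \<mu>) \<mu>"

definition borel_regular :: "('a::topological_space set \<Rightarrow> ennreal) \<Rightarrow> bool" where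
  "borel_regular \<mu> \<longleftrightarrow>
     sets borel \<subseteq> lambda_system UNIV UNIV \<mu> \<and>
     (\<forall>E. \<exists>B\<in>sets borel. E \<subseteq> B \<and> \<mu> B = \<mu> E)"

locale doubling_metric_measure_space =
  fixes \<mu> :: "'a::metric_space set \<Rightarrow> ennreal"
  assumes locally_compact: "locally compact (UNIV :: 'a set)"
    and outer_measure: "outer_measure_space UNIV \<mu>"
    and borel_regular: "borel_regular \<mu>"
    and doubling: "\<exists>c\<ge>1::real. \<forall>x r. 0 < r \<longrightarrow> \<mu> (ball x (2 * r)) \<le> ennreal c * \<mu> (ball x r)"
    and ball_pos: "\<And>x r. 0 < r \<Longrightarrow> 0 < \<mu> (ball x r)"
    and ball_finite: "\<And>x r. 0 < r \<Longrightarrow> \<mu> (ball x r) < \<infinity>"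
    and sphere_null: "\<And>x r. 0 < r \<Longrightarrow> \<mu> (sphere x r) = 0"
    and point_null: "\<And>x. \<mu> {x} = 0"

text \<open>
  The Riesz potential is only needed for non-negative \<open>f\<close>; its values lie in \<open>[0,\<infinity>]\<close>, and the
  negative part of \<open>f\<close> would be cut off by \<^const>\<open>ennreal\<close>. The point \<open>x\<close>, where the kernel would be
  \<open>1 / 0\<close>, is omitted from the domain of integration; every other ball occurring in the kernel
  has positive and finite measure, so \<^const>\<open>enn2real\<close> loses nothing.
\<close>

definition riesz_potential ::
    "('a::metric_space set \<Rightarrow> ennreal) \<Rightarrow> real \<Rightarrow> ('a \<Rightarrow> real) \<Rightarrow> 'a \<Rightarrow> ennreal" where
  "riesz_potential \<mu> \<gamma> f x =
     (\<integral>\<^sup>+y\<in>UNIV - {x}. ennreal (f y / enn2real (\<mu> (ball x (dist x y))) powr (1 - \<gamma>))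
        \<partial>caratheodory_measure \<mu>)"

text \<open>
  Elements of \<open>L\<^sup>p\<close> are represented by real-valued functions rather than by almost everywhere
  classes; the Riesz potential and the norm do not depend on the representative.
\<close>

definition Lp_space :: "('a set \<Rightarrow> ennreal) \<Rightarrow> real \<Rightarrow> ('a \<Rightarrow> real) set" where
  "Lp_space \<mu> p =
     {f \<in> borel_measurable (caratheodory_measure \<mu>).
        integrable (caratheodory_measure \<mu>) (\<lambda>x. \<bar>f x\<bar> powr p)}"

definition Lp_norm :: "('a set \<Rightarrow> ennreal) \<Rightarrow> real \<Rightarrow> ('a \<Rightarrow> real) \<Rightarrow> real" where
  "Lp_norm \<mu> p f = (\<integral>x. \<bar>f x\<bar> powr p \<partial>caratheodory_measure \<mu>) powr (1 / p)"

definition Lp_plus :: "('a set \<Rightarrow> ennreal) \<Rightarrow> real \<Rightarrow> ('a \<Rightarrow> real) set" where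
  "Lp_plus \<mu> p = {f \<in> Lp_space \<mu> p. \<forall>x. 0 \<le> f x}"

definition riesz_admissible ::
    "('a::metric_space set \<Rightarrow> ennreal) \<Rightarrow> real \<Rightarrow> real \<Rightarrow> 'a set \<Rightarrow> ('a \<Rightarrow> real) set" where
  "riesz_admissible \<mu> \<gamma> p E = {f \<in> Lp_plus \<mu> p. \<forall>x\<in>E. 1 \<le> riesz_potential \<mu> \<gamma> f x}"

text \<open>The infimum over the empty set is \<open>\<infinity>\<close> in \<^typ>\<open>ennreal\<close>.\<close>

definition riesz_capacity ::
    "('a::metric_space set \<Rightarrow> ennreal) \<Rightarrow> real \<Rightarrow> real \<Rightarrow> 'a set \<Rightarrow> ennreal" where
  "riesz_capacity \<mu> \<gamma> p E = (INF f\<in>riesz_admissible \<mu> \<gamma> p E. ennreal (Lp_norm \<mu> p f powr p))"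

definition fatou_capacity :: "('a set \<Rightarrow> ennreal) \<Rightarrow> bool" where
  "fatou_capacity C \<longleftrightarrow>
     (\<forall>A :: nat \<Rightarrow> 'a set. incseq A \<longrightarrow> (\<lambda>i. C (A i)) \<longlonglongrightarrow> C (\<Union>i. A i))"

end

theory Submission
  imports Defs
begin

text \<open>
  Monotonicity of the capacity reduces the claim to
  \<open>C (\<Union>i. A i) \<le> L = lim C (A i)\<close> with \<open>L\<close> finite. Choose \<open>f i\<close> admissible for \<open>A i\<close> whose energy
  \<open>\<integral> (f i)\<^sup>p\<close> exceeds \<open>C (A i)\<close> by less than \<open>1 / (i + 1)\<close>. For \<open>i \<le> j\<close> both \<open>f i\<close> and \<open>f j\<close> are
  admissible for the smaller set \<open>A i\<close>, and the potential is linear, so their midpoint is admissible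
  for \<open>A i\<close> as well and has energy at least \<open>C (A i)\<close>. All three energies are thus close to \<open>L\<close>,
  and the uniform convexity of \<open>t \<mapsto> t\<^sup>p\<close> forces \<open>f i\<close> and \<open>f j\<close> to be close. The convenient form
  of closeness is that of \<open>(f i)\<^sup>p\<close> and \<open>(f j)\<^sup>p\<close> in \<open>L\<^sup>1\<close> (\<open>near_minimizers_Cauchy\<close>, resting on the
  pointwise estimate \<open>powr_diff_le_midpoint_gap\<close>).

  One could now pass to an \<open>L\<^sup>p\<close> limit, but the potential of the limit is only known to be at
  least one outside a set of capacity zero. Instead, along a subsequence \<open>r\<close> with summable increments, the function
  \<open>F = ((f (r 0))\<^sup>p + \<Sum>k. \<bar>(f (r (k + 1)))\<^sup>p - (f (r k))\<^sup>p\<bar>) powr (1 / p)\<close> dominates every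
  \<open>f (r k)\<close>, while its energy exceeds that of \<open>f (r 0)\<close> only by the sum of the increments
  (\<open>summable_variation_envelope\<close>). Since the potential is monotone, \<open>F\<close> is admissible for every
  \<open>A (r k)\<close>, hence for their union, with no exceptional set; and its energy is as close to \<open>L\<close> as
  desired.
\<close>

section \<open>Uniform convexity of powers\<close>

lemma powr_midpoint_less:
  fixes a b p :: real
  assumes p: "1 < p" and a: "0 \<le> a" and b: "0 \<le> b" and ne: "a \<noteq> b"
  shows "((a + b) / 2) powr p < (a powr p + b powr p) / 2"
  using a b ne
proof (induction a b rule: linorder_wlog)
  case (le a b)
  define m where "m = (a + b) / 2"
  have m: "a < m" "m < b" "b - m = m - a" using le by (auto simp: m_def field_simps)
  have mvt: "\<exists>z. s < z \<and> z < t \<and> t powr p - s powr p = (t - s) * (p * z powr (p - 1))"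
    if "0 \<le> s" "s < t" for s t :: real
  proof -
    have "\<exists>l z. s < z \<and> z < t \<and> DERIV (\<lambda>x. x powr p) z :> l \<and> t powr p - s powr p = (t - s) * l"
      using that p
      by (intro MVT continuous_on_powr' continuous_intros)
         (auto simp: real_differentiable_def intro!: exI has_real_derivative_powr)
    then obtain l z where z: "s < z" "z < t" "DERIV (\<lambda>x. x powr p) z :> l"
      "t powr p - s powr p = (t - s) * l" by blast
    have "l = p * z powr (p - 1)"
      using DERIV_unique[OF z(3) has_real_derivative_powr] z that by simp
    with z show ?thesis by blast
  qed
  obtain y where y: "a < y" "y < m" "m powr p - a powr p = (m - a) * (p * y powr (p - 1))"
    using mvt[of a m] le m by auto
  obtain z where z: "m < z" "z < b" "b powr p - m powr p = (b - m) * (p * z powr (p - 1))"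
    using mvt[of m b] le m by auto
  have "y powr (p - 1) < z powr (p - 1)"
    using y z le p by (intro powr_less_mono2) auto
  then have "(m - a) * (p * y powr (p - 1)) < (m - a) * (p * z powr (p - 1))"
    using m p by (intro mult_strict_left_mono) auto
  then have "m powr p - a powr p < b powr p - m powr p"
    using y(3) z(3) m(3) by simp
  then show ?case by (simp add: m_def)
next
  case (sym a b)
  then show ?case by (simp add: add.commute)
qed

lemma powr_midpoint_le:
  fixes a b p :: real
  assumes "1 < p" "0 \<le> a" "0 \<le> b"
  shows "((a + b) / 2) powr p \<le> (a powr p + b powr p) / 2"
  using powr_midpoint_less[OF assms] by (cases "a = b") auto

text \<open>
  By homogeneity only \<open>a + b = 1\<close> matters. Where the left-hand side is not already absorbed by
  \<open>\<epsilon> * (a powr p + b powr p)\<close>, the point \<open>(a, b)\<close> stays in a compact set away from the diagonal, and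
  there strict convexity bounds the gap from below by a positive constant \<open>m\<close>, whereas the left-hand
  side is at most one; take \<open>K = 1 / m\<close>.
\<close>

lemma powr_diff_le_midpoint_gap:
  fixes p \<epsilon> :: real
  assumes p: "1 < p" and \<epsilon>: "0 < \<epsilon>"
  shows "\<exists>K\<ge>0. \<forall>a\<ge>0. \<forall>b\<ge>0. \<bar>a powr p - b powr p\<bar>
           \<le> \<epsilon> * (a powr p + b powr p) + K * ((a powr p + b powr p) / 2 - ((a + b) / 2) powr p)"
proof -
  define h :: "real \<Rightarrow> real" where "h t = (t powr p + (1 - t) powr p) / 2 - (1 / 2) powr p" for t
  define u :: "real \<Rightarrow> real"
    where "u t = \<bar>t powr p - (1 - t) powr p\<bar> - \<epsilon> * (t powr p + (1 - t) powr p)" for t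
  define T where "T = {0..1} \<inter> u -` {0..}"
  have "continuous_on {0..1} u" "continuous_on {0..1} h"
    unfolding u_def h_def using p by (intro continuous_intros continuous_on_powr'; auto)+
  moreover from this(1) have "closed T"
    unfolding T_def by (rule continuous_closed_preimage) auto
  ultimately have T: "compact T" "continuous_on T h"
    by (auto simp: T_def compact_eq_bounded_closed intro: continuous_on_subset bounded_subset[of "{0..1}"])
  have h0: "0 \<le> h t" if "t \<in> {0..1}" for t
    using powr_midpoint_le[OF p, of t "1 - t"] that by (simp add: h_def)
  have hpos: "0 < h t" if t: "t \<in> T" for t
  proof -
    have "u (1 / 2) < 0" using \<epsilon> by (simp add: u_def)
    moreover have "0 \<le> u t" using t by (simp add: T_def)
    ultimately have "t \<noteq> 1 / 2" by (metis not_le)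
    then show ?thesis
      using powr_midpoint_less[OF p, of t "1 - t"] t by (auto simp: h_def T_def)
  qed
  have "\<exists>m>0. \<forall>t\<in>T. m \<le> h t"
  proof (cases "T = {}")
    case False
    with continuous_attains_inf[OF T(1) False T(2)] hpos show ?thesis by blast
  qed (auto intro: exI[of _ 1])
  then obtain m where m: "0 < m" "\<And>t. t \<in> T \<Longrightarrow> m \<le> h t" by blast
  have unit: "u t \<le> 1 / m * h t" if t: "t \<in> {0..1}" for t
  proof (cases "t \<in> T")
    case True
    have "t powr p \<le> 1" "(1 - t) powr p \<le> 1"
      using t p by (auto intro!: powr_le1)
    then have "\<bar>t powr p - (1 - t) powr p\<bar> \<le> 1"
      using powr_ge_zero[of t p] powr_ge_zero[of "1 - t" p] by linarith
    moreover have "0 \<le> \<epsilon> * (t powr p + (1 - t) powr p)" using \<epsilon> by simp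
    ultimately have "u t \<le> 1" by (simp add: u_def)
    also have "1 \<le> 1 / m * h t" using m(1) m(2)[OF True] by (simp add: field_simps)
    finally show ?thesis .
  next
    case False
    then have "u t \<le> 0" using t by (auto simp: T_def)
    also have "0 \<le> 1 / m * h t" using m(1) h0[OF t] by simp
    finally show ?thesis .
  qed
  have "\<bar>a powr p - b powr p\<bar>
           \<le> \<epsilon> * (a powr p + b powr p) + 1 / m * ((a powr p + b powr p) / 2 - ((a + b) / 2) powr p)"
    if ab: "0 \<le> a" "0 \<le> b" for a b
  proof (cases "a + b = 0")
    case True
    with ab have "a = 0" "b = 0" by auto
    then show ?thesis by simp
  next
    case False
    define s t where "s = a + b" and "t = a / s"
    have s: "0 < s" using False ab by (simp add: s_def)
    have t: "t \<in> {0..1}" using ab s by (auto simp: t_def s_def field_simps)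
    have a: "a powr p = s powr p * t powr p"
      using s t ab by (subst powr_mult[symmetric]) (auto simp: t_def)
    have "b = s * (1 - t)" using s by (simp add: t_def right_diff_distrib) (simp add: s_def)
    then have b: "b powr p = s powr p * (1 - t) powr p"
      using s t by (simp add: powr_mult)
    have c: "((a + b) / 2) powr p = s powr p * (1 / 2) powr p"
      using s by (subst powr_mult[symmetric]) (auto simp: s_def)
    have "s powr p * u t \<le> s powr p * (1 / m * h t)"
      using unit[OF t] by (intro mult_left_mono) auto
    moreover have "s powr p * u t = \<bar>a powr p - b powr p\<bar> - \<epsilon> * (a powr p + b powr p)"
      unfolding a b u_def right_diff_distrib[symmetric] abs_mult by (simp add: algebra_simps)
    moreover have "s powr p * (1 / m * h t)
        = 1 / m * ((a powr p + b powr p) / 2 - ((a + b) / 2) powr p)"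
      unfolding a b c h_def using m(1) by (simp add: field_simps)
    ultimately show ?thesis by linarith
  qed
  then show ?thesis using m(1) by (intro exI[of _ "1 / m"]) auto
qed

section \<open>Near-minimizers of the energy\<close>

definition nonneg_Lp :: "'a measure \<Rightarrow> real \<Rightarrow> ('a \<Rightarrow> real) set" where
  "nonneg_Lp M p = {f \<in> borel_measurable M. (\<forall>x. 0 \<le> f x) \<and> integrable M (\<lambda>x. f x powr p)}"

lemma nonneg_LpD:
  assumes "f \<in> nonneg_Lp M p"
  shows "f \<in> borel_measurable M" "\<And>x. 0 \<le> f x" "integrable M (\<lambda>x. f x powr p)"
  using assms by (auto simp: nonneg_Lp_def)

lemma midpoint_in_nonneg_Lp:
  assumes p: "1 < p" and f: "f \<in> nonneg_Lp M p" and g: "g \<in> nonneg_Lp M p"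
  shows "(\<lambda>x. (f x + g x) / 2) \<in> nonneg_Lp M p"
proof -
  note [measurable] = nonneg_LpD(1)[OF f] nonneg_LpD(1)[OF g]
  note nn = nonneg_LpD(2)[OF f] nonneg_LpD(2)[OF g]
  note [simp] = nonneg_LpD(3)[OF f] nonneg_LpD(3)[OF g]
  have "integrable M (\<lambda>x. ((f x + g x) / 2) powr p)"
    by (rule Bochner_Integration.integrable_bound[where f="\<lambda>x. (f x powr p + g x powr p) / 2"])
       (use powr_midpoint_le[OF p nn] in \<open>auto intro!: AE_I2\<close>)
  then show ?thesis using nn by (auto simp: nonneg_Lp_def)
qed

lemma integral_powr_diff_le_midpoint_gap:
  assumes p: "1 < p" and f: "f \<in> nonneg_Lp M p" and g: "g \<in> nonneg_Lp M p"
    and K: "\<And>a b. 0 \<le> a \<Longrightarrow> 0 \<le> b \<Longrightarrow> \<bar>a powr p - b powr p\<bar>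
           \<le> \<epsilon> * (a powr p + b powr p) + K * ((a powr p + b powr p) / 2 - ((a + b) / 2) powr p)"
  shows "(\<integral>x. \<bar>f x powr p - g x powr p\<bar> \<partial>M)
    \<le> \<epsilon> * ((\<integral>x. f x powr p \<partial>M) + (\<integral>x. g x powr p \<partial>M))
      + K * (((\<integral>x. f x powr p \<partial>M) + (\<integral>x. g x powr p \<partial>M)) / 2 - (\<integral>x. ((f x + g x) / 2) powr p \<partial>M))"
proof -
  note [simp] = nonneg_LpD(3)[OF f] nonneg_LpD(3)[OF g] nonneg_LpD(3)[OF midpoint_in_nonneg_Lp[OF p f g]]
  have "(\<integral>x. \<bar>f x powr p - g x powr p\<bar> \<partial>M)
     \<le> (\<integral>x. \<epsilon> * (f x powr p + g x powr p)
          + K * ((f x powr p + g x powr p) / 2 - ((f x + g x) / 2) powr p) \<partial>M)"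
    using K nonneg_LpD(2)[OF f] nonneg_LpD(2)[OF g] by (intro integral_mono) auto
  then show ?thesis by simp
qed

text \<open>
  The gap between the mean of the two energies and the energy of the midpoint is at most
  \<open>L + 1 / (i + 1) - c i\<close>, which tends to zero. This controls the second term of
  \<open>powr_diff_le_midpoint_gap\<close> once \<open>\<epsilon>\<close>, and with it \<open>K\<close>, has been fixed to make the first one small.
\<close>

lemma near_minimizers_Cauchy:
  fixes c :: "nat \<Rightarrow> real"
  assumes p: "1 < p"
    and f: "\<And>i. f i \<in> nonneg_Lp M p"
    and near: "\<And>i. (\<integral>x. f i x powr p \<partial>M) \<le> c i + 1 / Suc i"
    and mid: "\<And>i j. i \<le> j \<Longrightarrow> c i \<le> (\<integral>x. ((f i x + f j x) / 2) powr p \<partial>M)"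
    and c: "incseq c" "c \<longlonglongrightarrow> L"
    and \<eta>: "0 < \<eta>"
  shows "\<exists>N. \<forall>i\<ge>N. \<forall>j\<ge>i. (\<integral>x. \<bar>f j x powr p - f i x powr p\<bar> \<partial>M) < \<eta>"
proof -
  have cL: "c i \<le> L" for i using incseq_le[OF c] .
  have E_le: "(\<integral>x. f j x powr p \<partial>M) \<le> L + 1 / Suc i" if "i \<le> j" for i j
  proof -
    have "1 / real (Suc j) \<le> 1 / real (Suc i)" using that by (simp add: frac_le)
    then show ?thesis using near[of j] cL[of j] by linarith
  qed
  have "0 \<le> (\<integral>x. f 0 x powr p \<partial>M)" by (rule integral_nonneg_AE) simp
  with E_le[of 0 0] have L1: "0 \<le> L + 1" by linarith
  define \<epsilon> where "\<epsilon> = \<eta> / (4 * (L + 2))"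
  have \<epsilon>: "0 < \<epsilon>" "\<epsilon> * (2 * (L + 2)) = \<eta> / 2" using \<eta> L1 by (auto simp: \<epsilon>_def field_simps)
  obtain K where K: "0 \<le> K" "\<And>a b. 0 \<le> a \<Longrightarrow> 0 \<le> b \<Longrightarrow> \<bar>a powr p - b powr p\<bar>
           \<le> \<epsilon> * (a powr p + b powr p) + K * ((a powr p + b powr p) / 2 - ((a + b) / 2) powr p)"
    using powr_diff_le_midpoint_gap[OF p \<epsilon>(1)] by auto
  have "(\<lambda>i. K * (L + 1 / Suc i - c i)) \<longlonglongrightarrow> K * (L + 0 - L)"
    using LIMSEQ_inverse_real_of_nat by (intro tendsto_intros c) (simp add: inverse_eq_divide)
  then have "\<forall>\<^sub>F i in sequentially. K * (L + 1 / Suc i - c i) < \<eta> / 2"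
    using \<eta> by (intro order_tendstoD) auto
  then obtain N where N: "\<And>i. N \<le> i \<Longrightarrow> K * (L + 1 / Suc i - c i) < \<eta> / 2"
    by (auto simp: eventually_sequentially)
  have "(\<integral>x. \<bar>f j x powr p - f i x powr p\<bar> \<partial>M) < \<eta>" if ij: "N \<le> i" "i \<le> j" for i j
  proof -
    let ?E = "\<lambda>i. \<integral>x. f i x powr p \<partial>M" and ?m = "\<integral>x. ((f i x + f j x) / 2) powr p \<partial>M"
    have "?E i + ?E j \<le> 2 * (L + 2)" using E_le[of 0 i] E_le[of 0 j] by simp
    then have first: "\<epsilon> * (?E i + ?E j) \<le> \<eta> / 2"
      using \<epsilon> by (metis mult_left_mono less_imp_le)
    have "K * ((?E i + ?E j) / 2 - ?m) \<le> K * (L + 1 / Suc i - c i)"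
    proof (rule mult_left_mono[OF _ K(1)])
      show "(?E i + ?E j) / 2 - ?m \<le> L + 1 / Suc i - c i"
        using E_le[OF order_refl, of i] E_le[OF ij(2)] mid[OF ij(2)] by argo
    qed
    also have "\<dots> < \<eta> / 2" by (rule N[OF ij(1)])
    finally have "\<epsilon> * (?E i + ?E j) + K * ((?E i + ?E j) / 2 - ?m) < \<eta> / 2 + \<eta> / 2"
      by (rule add_le_less_mono[OF first])
    moreover have "(\<integral>x. \<bar>f i x powr p - f j x powr p\<bar> \<partial>M)
        \<le> \<epsilon> * (?E i + ?E j) + K * ((?E i + ?E j) / 2 - ?m)"
      by (rule integral_powr_diff_le_midpoint_gap[OF p f f K(2)])
    ultimately show ?thesis by (simp add: abs_minus_commute)
  qed
  then show ?thesis by blast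
qed

text \<open>
  Passage to a subsequence that keeps pace with countably many eventual properties, such as being
  within \<open>2 ^ -k\<close> of all later members.
\<close>

lemma fast_subsequence:
  fixes P :: "nat \<Rightarrow> nat \<Rightarrow> nat \<Rightarrow> bool"
  assumes "\<And>k. \<exists>N. \<forall>i\<ge>N. \<forall>j\<ge>i. P k i j"
  obtains r :: "nat \<Rightarrow> nat" where "strict_mono r" "\<And>k j. r k \<le> j \<Longrightarrow> P k (r k) j"
proof -
  obtain N where N: "\<And>k i j. N k \<le> i \<Longrightarrow> i \<le> j \<Longrightarrow> P k i j" using assms by metis
  define r where "r k = k + (\<Sum>l\<le>k. N l)" for k
  have "N k \<le> r k" for k
    using member_le_sum[of k "{..k}" N] by (simp add: r_def)
  then show ?thesis using N by (intro that[of r]) (auto simp: strict_mono_Suc_iff r_def)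
qed

text \<open>
  Telescoping gives \<open>(f k)\<^sup>p \<le> (f 0)\<^sup>p + \<Sum>l<k. \<bar>(f (l + 1))\<^sup>p - (f l)\<^sup>p\<bar>\<close>. The full series
  has finite integral by monotone convergence, so it is finite almost everywhere, and there its
  \<open>p\<close>-th root dominates the whole sequence.
\<close>

lemma summable_variation_envelope:
  assumes p: "0 < p"
    and f: "\<And>k. f k \<in> nonneg_Lp M p"
    and e: "\<And>k. (\<integral>x. \<bar>f (Suc k) x powr p - f k x powr p\<bar> \<partial>M) \<le> e k" "e sums s"
  shows "\<exists>F\<in>nonneg_Lp M p. (\<integral>x. F x powr p \<partial>M) \<le> (\<integral>x. f 0 x powr p \<partial>M) + s
           \<and> (\<forall>k. AE x in M. f k x \<le> F x)"
proof -
  note [measurable] = nonneg_LpD(1)[OF f]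
  note [simp] = nonneg_LpD(3)[OF f] 
  define d where "d k x = \<bar>f (Suc k) x powr p - f k x powr p\<bar>" for k x
  have [measurable]: "d k \<in> borel_measurable M" for k unfolding d_def by measurable
  define G where "G x = ennreal (f 0 x powr p) + (\<Sum>k. ennreal (d k x))" for x
  have [measurable]: "G \<in> borel_measurable M" unfolding G_def by measurable
  have e0: "0 \<le> e k" for k
    by (rule order_trans[OF _ e(1)[of k]]) simp
  have s0: "0 \<le> s" using e0 e(2) sums_unique suminf_nonneg sums_summable by metis
  have d_le: "(\<integral>\<^sup>+x. d k x \<partial>M) \<le> ennreal (e k)" for k
  proof -
    have "integrable M (d k)" unfolding d_def by simp
    then have "(\<integral>\<^sup>+x. d k x \<partial>M) = ennreal (\<integral>x. d k x \<partial>M)"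
      by (rule nn_integral_eq_integral) (simp add: d_def)
    then show ?thesis using e(1)[of k] by (simp add: d_def ennreal_leI)
  qed
  have "(\<integral>\<^sup>+x. G x \<partial>M) = (\<integral>\<^sup>+x. f 0 x powr p \<partial>M) + (\<Sum>k. \<integral>\<^sup>+x. d k x \<partial>M)"
    unfolding G_def by (simp add: nn_integral_add nn_integral_suminf)
  also have "\<dots> \<le> ennreal (\<integral>x. f 0 x powr p \<partial>M) + (\<Sum>k. ennreal (e k))"
    by (intro add_mono suminf_le d_le) (auto simp: nn_integral_eq_integral)
  also have "(\<Sum>k. ennreal (e k)) = ennreal s"
    by (rule suminf_ennreal_eq[OF e0 e(2)])
  also have "ennreal (\<integral>x. f 0 x powr p \<partial>M) + ennreal s = ennreal ((\<integral>x. f 0 x powr p \<partial>M) + s)"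
    using s0 by simp
  finally have G_le: "(\<integral>\<^sup>+x. G x \<partial>M) \<le> ennreal ((\<integral>x. f 0 x powr p \<partial>M) + s)" .
  then have G_fin: "AE x in M. G x \<noteq> \<infinity>"
    by (intro nn_integral_PInf_AE) (auto simp: top_unique)
  (* F is 0 on the null set where G is infinite, so it dominates the sequence only almost everywhere. *)
  define F where "F x = enn2real (G x) powr (1 / p)" for x
  have [measurable]: "F \<in> borel_measurable M" unfolding F_def by measurable
  have Fp: "F x powr p = enn2real (G x)" for x
    using p by (simp add: F_def powr_powr)
  have "(\<integral>\<^sup>+x. ennreal (F x powr p) \<partial>M) = (\<integral>\<^sup>+x. G x \<partial>M)"
    using G_fin by (intro nn_integral_cong_AE) (auto simp: Fp less_top)
  then have Fp_le: "(\<integral>\<^sup>+x. ennreal (F x powr p) \<partial>M) \<le> ennreal ((\<integral>x. f 0 x powr p \<partial>M) + s)"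
    using G_le by simp
  then have int: "integrable M (\<lambda>x. F x powr p)"
    by (intro integrableI_nonneg) (auto intro: le_less_trans)
  have "(\<integral>x. F x powr p \<partial>M) \<le> (\<integral>x. f 0 x powr p \<partial>M) + s"
  proof -
    have "0 \<le> (\<integral>x. f 0 x powr p \<partial>M) + s"
      using s0 by (intro add_nonneg_nonneg integral_nonneg_AE) auto
    moreover have "ennreal (\<integral>x. F x powr p \<partial>M) \<le> ennreal ((\<integral>x. f 0 x powr p \<partial>M) + s)"
      using Fp_le nn_integral_eq_integral[OF int] by auto
    ultimately show ?thesis by (simp only: ennreal_le_iff)
  qed
  moreover have "F \<in> nonneg_Lp M p"
    using int by (simp add: nonneg_Lp_def F_def)
  moreover have "AE x in M. f k x \<le> F x" for k
    using G_fin
  proof eventually_elim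
    case (elim x)
    have step: "f k x powr p \<le> f 0 x powr p + (\<Sum>l<k. d l x)"
      by (induction k) (auto simp: d_def)
    have "ennreal (f k x powr p) \<le> ennreal (f 0 x powr p) + (\<Sum>l<k. ennreal (d l x))"
      using ennreal_leI[OF step] by (simp add: d_def sum_nonneg sum_ennreal)
    also have "\<dots> \<le> G x"
      unfolding G_def by (intro add_left_mono sum_le_suminf) auto
    finally have "f k x powr p \<le> enn2real (G x)"
      using elim by (metis enn2real_mono enn2real_ennreal infinity_ennreal_def less_top powr_ge_zero)
    then have "(f k x powr p) powr (1 / p) \<le> F x"
      unfolding F_def using p by (intro powr_mono2) auto
    then show ?case using p nonneg_LpD(2)[OF f] by (simp add: powr_powr)
  qed
  ultimately show ?thesis by blast
qed

text \<open>
  The abstract core: for decreasing midpoint-convex classes \<open>S i\<close> whose minimal energies stay below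
  \<open>L\<close>, arbitrarily little more than \<open>L\<close> suffices to dominate a member of every single \<open>S i\<close>. In the
  application, \<open>S i\<close> consists of the functions admissible for the \<open>i\<close>-th set.
\<close>

lemma near_minimizers_envelope:
  fixes S :: "nat \<Rightarrow> ('a \<Rightarrow> real) set"
  assumes p: "1 < p"
    and S: "decseq S" "\<And>i. S i \<noteq> {}" "\<And>i. S i \<subseteq> nonneg_Lp M p"
    and mid: "\<And>i f g. f \<in> S i \<Longrightarrow> g \<in> S i \<Longrightarrow> (\<lambda>x. (f x + g x) / 2) \<in> S i"
    and L: "\<And>i. (INF f\<in>S i. \<integral>x. f x powr p \<partial>M) \<le> L"
    and \<eta>: "0 < \<eta>"
  shows "\<exists>F\<in>nonneg_Lp M p. (\<integral>x. F x powr p \<partial>M) \<le> L + \<eta>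
           \<and> (\<forall>i. \<exists>f\<in>S i. AE x in M. f x \<le> F x)"
proof -
  let ?E = "\<lambda>f. \<integral>x. f x powr p \<partial>M"
  define c where "c i = (INF f\<in>S i. ?E f)" for i
  have bdd: "bdd_below (?E ` S i)" for i
    by (rule bdd_belowI[of _ 0]) auto
  have c_le: "c i \<le> ?E f" if "f \<in> S i" for i f
    unfolding c_def by (rule cINF_lower[OF bdd that])
  have inc: "incseq c"
    unfolding c_def using S(1,2) bdd
    by (intro monoI cINF_superset_mono) (auto simp: antimono_def)
  have cL: "c i \<le> L" for i using L by (simp add: c_def)
  obtain l where l: "c \<longlonglongrightarrow> l" using incseq_convergent[OF inc] cL by blast
  have lL: "l \<le> L" using cL by (intro LIMSEQ_le_const2[OF l]) auto
  have "\<exists>f\<in>S i. ?E f < c i + 1 / Suc i" for i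
    using cINF_less_iff[OF S(2) bdd, of i "c i + 1 / Suc i"] by (simp add: c_def)
  then obtain f where f: "\<And>i. f i \<in> S i" "\<And>i. ?E (f i) < c i + 1 / Suc i" by metis
  have fS: "f j \<in> S i" if "i \<le> j" for i j
    using f(1)[of j] S(1) that by (auto simp: antimono_def)
  have fLp: "f i \<in> nonneg_Lp M p" for i using f(1) S(3) by blast
  (* The first condition makes the increments along the subsequence sum to at most \<eta>/2; the second
     spends the other \<eta>/2 on the distance of its first member from the minimal energy. *)
  define P where "P k i j \<longleftrightarrow> (\<integral>x. \<bar>f j x powr p - f i x powr p\<bar> \<partial>M) < \<eta> / 2 * (1 / 2) ^ Suc k
      \<and> 1 / Suc i < \<eta> / 2" for k i j :: nat
  have P: "\<exists>N. \<forall>i\<ge>N. \<forall>j\<ge>i. P k i j" for k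
  proof -
    have "0 < \<eta> / 2 * (1 / 2) ^ Suc k" using \<eta> by simp
    from near_minimizers_Cauchy[OF p fLp less_imp_le[OF f(2)] c_le[OF mid[OF f(1) fS]] inc l this]
    obtain N1 where N1: "\<And>i j. N1 \<le> i \<Longrightarrow> i \<le> j \<Longrightarrow>
        (\<integral>x. \<bar>f j x powr p - f i x powr p\<bar> \<partial>M) < \<eta> / 2 * (1 / 2) ^ Suc k"
      by blast
    have "\<forall>\<^sub>F i in sequentially. 1 / Suc i < \<eta> / 2"
      using LIMSEQ_inverse_real_of_nat \<eta>
      by (intro order_tendstoD(2)[where y=0]) (auto simp: inverse_eq_divide)
    then obtain N2 where "\<And>i. N2 \<le> i \<Longrightarrow> 1 / Suc i < \<eta> / 2"
      by (auto simp: eventually_sequentially)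
    with N1 show ?thesis by (intro exI[of _ "max N1 N2"]) (auto simp: P_def)
  qed
  obtain r where r: "strict_mono r" "\<And>k j. r k \<le> j \<Longrightarrow> P k (r k) j"
    using fast_subsequence[of P, OF P] by blast
  have "(\<lambda>k. \<eta> / 2 * (1 / 2) ^ Suc k) sums (\<eta> / 2 * 1)"
    by (intro sums_mult power_half_series)
  moreover have "(\<integral>x. \<bar>f (r (Suc k)) x powr p - f (r k) x powr p\<bar> \<partial>M) \<le> \<eta> / 2 * (1 / 2) ^ Suc k" for k
    using r(2)[of k "r (Suc k)"] strict_monoD[OF r(1), of k "Suc k"] by (simp add: P_def)
  ultimately have "\<exists>F\<in>nonneg_Lp M p. ?E F \<le> ?E (f (r 0)) + \<eta> / 2 * 1
      \<and> (\<forall>k. AE x in M. f (r k) x \<le> F x)"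
    using p by (intro summable_variation_envelope[OF _ fLp]) auto
  then obtain F where F: "F \<in> nonneg_Lp M p" "?E F \<le> ?E (f (r 0)) + \<eta> / 2 * 1"
      "\<And>k. AE x in M. f (r k) x \<le> F x"
    by blast
  have "?E F \<le> L + \<eta>"
    using F(2) f(2)[of "r 0"] cL[of "r 0"] r(2)[of 0 "r 0"] by (simp add: P_def)
  moreover have "\<exists>g\<in>S i. AE x in M. g x \<le> F x" for i
    using F(3)[of i] fS[OF seq_suble[OF r(1)]] by blast
  ultimately show ?thesis using F(1) by blast
qed

section \<open>Riesz potentials and capacities\<close>

lemma Lp_plus_eq_nonneg_Lp: "Lp_plus \<mu> p = nonneg_Lp (caratheodory_measure \<mu>) p"
  by (auto simp: Lp_plus_def Lp_space_def nonneg_Lp_def)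

lemma Lp_norm_powr:
  assumes "0 < p" "f \<in> Lp_plus \<mu> p"
  shows "Lp_norm \<mu> p f powr p = (\<integral>x. f x powr p \<partial>caratheodory_measure \<mu>)"
  using assms by (simp add: Lp_norm_def powr_powr Lp_plus_def)

lemma riesz_potential_mono_AE:
  assumes "AE y in caratheodory_measure \<mu>. f y \<le> g y"
  shows "riesz_potential \<mu> \<gamma> f x \<le> riesz_potential \<mu> \<gamma> g x"
  unfolding riesz_potential_def
proof (rule nn_integral_mono_AE, use assms in eventually_elim)
  case (elim y)
  then show ?case
    by (intro mult_right_mono ennreal_leI divide_right_mono) auto
qed

context doubling_metric_measure_space
begin

lemma borel_subset_sets: "sets borel \<subseteq> sets (caratheodory_measure \<mu>)"
proof -
  have "lambda_system UNIV UNIV \<mu> \<subseteq> sets (caratheodory_measure \<mu>)"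
    by (auto simp: caratheodory_measure_def)
  then show ?thesis using borel_regular by (auto simp: borel_regular_def)
qed

lemma space_caratheodory_measure [simp]: "space (caratheodory_measure \<mu>) = UNIV"
  by (simp add: caratheodory_measure_def space_measure_of_conv)

lemma measurable_from_borel:
  assumes "g \<in> borel_measurable borel"
  shows "g \<in> borel_measurable (caratheodory_measure \<mu>)"
  using measurable_sets[OF assms] borel_subset_sets by (auto intro!: measurableI)

lemma mono_ball_measure: "mono (\<lambda>r. enn2real (\<mu> (ball x r)))"
proof (rule monoI)
  fix r s :: real assume rs: "r \<le> s"
  have "increasing UNIV \<mu>" "\<mu> {} = 0"
    using outer_measure by (auto simp: outer_measure_space_def positive_def)
  then have "\<mu> (ball x r) \<le> \<mu> (ball x s)" "\<mu> (ball x s) < \<infinity>"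
    using rs ball_finite[of s x] by (cases "0 < s"; simp add: increasing_def subset_ball ball_empty)+
  then show "enn2real (\<mu> (ball x r)) \<le> enn2real (\<mu> (ball x s))"
    by (intro enn2real_mono) auto
qed

text \<open>
  The measure of a ball is a monotone, hence Borel, function of its radius, and the radius
  \<open>dist x y\<close> is continuous in \<open>y\<close>. Measurability is what makes the potential additive.
\<close>

lemma kernel_measurable:
  "(\<lambda>y. enn2real (\<mu> (ball x (dist x y))) powr s) \<in> borel_measurable (caratheodory_measure \<mu>)"
proof -
  have [measurable]: "(\<lambda>r. enn2real (\<mu> (ball x r))) \<in> borel_measurable borel"
    by (rule borel_measurable_mono[OF mono_ball_measure])
  have [measurable]: "(\<lambda>y. dist x y) \<in> borel_measurable borel"
    by (intro borel_measurable_continuous_onI continuous_intros)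
  have "(\<lambda>y. enn2real (\<mu> (ball x (dist x y))) powr s) \<in> borel_measurable borel"
    by measurable
  then show ?thesis by (rule measurable_from_borel)
qed

lemma riesz_potential_midpoint:
  assumes f: "f \<in> Lp_plus \<mu> p" and g: "g \<in> Lp_plus \<mu> p"
  shows "riesz_potential \<mu> \<gamma> (\<lambda>y. (f y + g y) / 2) x
    = (riesz_potential \<mu> \<gamma> f x + riesz_potential \<mu> \<gamma> g x) / 2"
proof -
  let ?M = "caratheodory_measure \<mu>"
  let ?k = "\<lambda>y. enn2real (\<mu> (ball x (dist x y))) powr (1 - \<gamma>)"
  note [measurable] = kernel_measurable
  have [measurable]: "f \<in> borel_measurable ?M" "g \<in> borel_measurable ?M"
    using f g by (auto simp: Lp_plus_def Lp_space_def)
  have [measurable]: "UNIV - {x} \<in> sets ?M" using borel_subset_sets by auto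
  have nn: "0 \<le> f y" "0 \<le> g y" for y using f g by (auto simp: Lp_plus_def)
  have "ennreal ((f y + g y) / 2 / ?k y) = (ennreal (f y / ?k y) + ennreal (g y / ?k y)) / 2" for y
  proof -
    have "(f y + g y) / 2 / ?k y = (f y / ?k y + g y / ?k y) / 2"
      by (simp add: add_divide_distrib)
    then show ?thesis
      using nn[of y] divide_ennreal[of "f y / ?k y + g y / ?k y" 2] by simp
  qed
  then have "riesz_potential \<mu> \<gamma> (\<lambda>y. (f y + g y) / 2) x
     = (\<integral>\<^sup>+y. (ennreal (f y / ?k y) * indicator (UNIV - {x}) y
          + ennreal (g y / ?k y) * indicator (UNIV - {x}) y) / 2 \<partial>?M)"
    unfolding riesz_potential_def
    by (intro nn_integral_cong) (auto simp: indicator_def)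
  also have "\<dots> = (riesz_potential \<mu> \<gamma> f x + riesz_potential \<mu> \<gamma> g x) / 2"
    unfolding riesz_potential_def by (simp add: nn_integral_divide nn_integral_add)
  finally show ?thesis .
qed

lemma riesz_admissible_midpoint:
  assumes p: "1 < p"
    and f: "f \<in> riesz_admissible \<mu> \<gamma> p E" and g: "g \<in> riesz_admissible \<mu> \<gamma> p E"
  shows "(\<lambda>y. (f y + g y) / 2) \<in> riesz_admissible \<mu> \<gamma> p E"
proof -
  have Lp: "f \<in> Lp_plus \<mu> p" "g \<in> Lp_plus \<mu> p" using f g by (auto simp: riesz_admissible_def)
  have "1 \<le> riesz_potential \<mu> \<gamma> (\<lambda>y. (f y + g y) / 2) x" if "x \<in> E" for x
  proof -
    have "1 = (1 + 1) / (2::ennreal)" by simp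
    also have "\<dots> \<le> (riesz_potential \<mu> \<gamma> f x + riesz_potential \<mu> \<gamma> g x) / 2"
      using f g that by (intro divide_right_mono_ennreal add_mono) (auto simp: riesz_admissible_def)
    finally show ?thesis by (simp only: riesz_potential_midpoint[OF Lp])
  qed
  moreover have "(\<lambda>y. (f y + g y) / 2) \<in> Lp_plus \<mu> p"
    using midpoint_in_nonneg_Lp[OF p] Lp by (simp add: Lp_plus_eq_nonneg_Lp)
  ultimately show ?thesis by (simp add: riesz_admissible_def)
qed

text \<open>
  The envelope dominates an admissible function of each \<open>A i\<close> almost everywhere, so its potential is
  at least one at every point of the union.
\<close>

lemma riesz_capacity_Union_le:
  assumes p: "1 < p" and A: "incseq A" and L: "\<And>i. riesz_capacity \<mu> \<gamma> p (A i) \<le> ennreal L" "0 \<le> L"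
    and \<eta>: "0 < \<eta>"
  shows "riesz_capacity \<mu> \<gamma> p (\<Union>i. A i) \<le> ennreal (L + \<eta>)"
proof -
  let ?M = "caratheodory_measure \<mu>"
  let ?S = "\<lambda>i. riesz_admissible \<mu> \<gamma> p (A i)"
  have S_Lp: "?S i \<subseteq> nonneg_Lp ?M p" for i
    by (auto simp: riesz_admissible_def Lp_plus_eq_nonneg_Lp)
  have cap: "riesz_capacity \<mu> \<gamma> p E
      = (INF f\<in>riesz_admissible \<mu> \<gamma> p E. ennreal (\<integral>x. f x powr p \<partial>?M))" for E
    unfolding riesz_capacity_def using p
    by (intro INF_cong) (auto simp: riesz_admissible_def Lp_norm_powr)
  have ne: "?S i \<noteq> {}" for i
    using L(1)[of i] by (auto simp: cap top_unique)
  have bdd: "bdd_below ((\<lambda>f. \<integral>x. f x powr p \<partial>?M) ` ?S i)" for i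
    by (rule bdd_belowI[of _ 0]) auto
  have inf: "(INF f\<in>?S i. \<integral>x. f x powr p \<partial>?M) \<le> L" for i
  proof (rule field_le_epsilon)
    fix e :: real assume "0 < e"
    then have "riesz_capacity \<mu> \<gamma> p (A i) < ennreal (L + e)"
      using L by (intro le_less_trans[OF L(1)]) (auto simp: ennreal_less_iff)
    then obtain f where "f \<in> ?S i" "(\<integral>x. f x powr p \<partial>?M) < L + e"
      by (auto simp: cap INF_less_iff ennreal_less_iff)
    then show "(INF f\<in>?S i. \<integral>x. f x powr p \<partial>?M) \<le> L + e"
      using cINF_lower[OF bdd] by fastforce
  qed
  have "decseq ?S"
    using A by (force simp: antimono_def mono_def riesz_admissible_def)
  from near_minimizers_envelope[OF p this ne S_Lp riesz_admissible_midpoint[OF p] inf \<eta>]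
  obtain F where F: "F \<in> nonneg_Lp ?M p" "(\<integral>x. F x powr p \<partial>?M) \<le> L + \<eta>"
    "\<And>i. \<exists>f\<in>?S i. AE x in ?M. f x \<le> F x" by blast
  have "1 \<le> riesz_potential \<mu> \<gamma> F x" if "x \<in> A i" for x i
  proof -
    obtain f where f: "f \<in> ?S i" "AE x in ?M. f x \<le> F x" using F(3) by blast
    then have "1 \<le> riesz_potential \<mu> \<gamma> f x" using that by (simp add: riesz_admissible_def)
    also have "\<dots> \<le> riesz_potential \<mu> \<gamma> F x" by (rule riesz_potential_mono_AE[OF f(2)])
    finally show ?thesis .
  qed
  then have "F \<in> riesz_admissible \<mu> \<gamma> p (\<Union>i. A i)"
    using F(1) by (auto simp: riesz_admissible_def Lp_plus_eq_nonneg_Lp)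
  then have "riesz_capacity \<mu> \<gamma> p (\<Union>i. A i) \<le> ennreal (\<integral>x. F x powr p \<partial>?M)"
    unfolding cap by (rule INF_lower)
  also have "\<dots> \<le> ennreal (L + \<eta>)" using F(2) by (rule ennreal_leI)
  finally show ?thesis .
qed

end

lemma riesz_capacity_mono:
  assumes "E \<subseteq> E'"
  shows "riesz_capacity \<mu> \<gamma> p E \<le> riesz_capacity \<mu> \<gamma> p E'"
  unfolding riesz_capacity_def
  using assms by (intro INF_superset_mono) (auto simp: riesz_admissible_def)

theorem theorem3p12:
  fixes \<mu> :: "'a::metric_space set \<Rightarrow> ennreal" and \<gamma> p :: real
  assumes "doubling_metric_measure_space \<mu>"
    and "1 < p" and "0 < \<gamma>" and "\<gamma> < 1"
  shows "fatou_capacity (riesz_capacity \<mu> \<gamma> p)"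
  unfolding fatou_capacity_def
proof (intro allI impI)
  interpret doubling_metric_measure_space \<mu> by fact
  fix A :: "nat \<Rightarrow> 'a set" assume A: "incseq A"
  let ?C = "riesz_capacity \<mu> \<gamma> p"
  let ?L = "SUP i. ?C (A i)"
  have inc: "incseq (\<lambda>i. ?C (A i))"
    using A by (auto simp: mono_def intro: riesz_capacity_mono)
  have "?C (\<Union>i. A i) \<le> ?L"
  proof (rule ennreal_le_epsilon)
    fix e :: real assume "?L < top" "0 < e"
    then obtain L where L: "?L = ennreal L" "0 \<le> L" by (cases ?L) auto
    have "?C (A i) \<le> ennreal L" for i
      unfolding L(1)[symmetric] by (rule SUP_upper) simp
    from riesz_capacity_Union_le[OF \<open>1 < p\<close> A this L(2) \<open>0 < e\<close>]
    show "?C (\<Union>i. A i) \<le> ?L + ennreal e" using L \<open>0 < e\<close> by simp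
  qed
  moreover have "?L \<le> ?C (\<Union>i. A i)"
    by (intro SUP_least riesz_capacity_mono) auto
  ultimately have "?L = ?C (\<Union>i. A i)" by (rule antisym[rotated])
  then show "(\<lambda>i. ?C (A i)) \<longlonglongrightarrow> ?C (\<Union>i. A i)"
    using LIMSEQ_SUP[OF inc] by simp
qed

end
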